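(* Let $\langle\mathcal A,\to_{\mathcal A}\rangle$ and $\langle\mathcal B,\to_{\mathcal B}\rangle$ be strongly connected digraphs, let $\phi$ be an epimorphism from $\langle\mathcal B,\to_{\mathcal B}\rangle$ onto $\langle\mathcal A,\to_{\mathcal A}\rangle$, and let $\langle a_n:n\in\omega\rangle$ be a diligent walk through $\langle\mathcal A,\to_{\mathcal A}\rangle$. Then either (1) there is a diligent walk through $\langle\mathcal B,\to_{\mathcal B}\rangle$ that almost projects onto $\langle a_n:n\in\omega\rangle$ via $\phi$, or (2) there are a strongly connected digraph $\langle\mathcal C,\to_{\mathcal C}\rangle$, an epimorphism $\psi$ from $\langle\mathcal C,\to_{\mathcal C}\rangle$ onto $\langle\mathcal A,\to_{\mathcal A}\rangle$, and a diligent walk through $\langle\mathcal C,\to_{\mathcal C}\rangle$ that almost projects onto $\langle a_n:n\in\omega\rangle$ via $\psi$, such that $\psi$ and $\phi$ are incompatible.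
   Context: Digraphs are finite vertex sets with a binary relation (loops allowed); strongly connected means any vertex reaches any vertex by a walk (finite sequence $v_0,\dots,v_n$ with $v_i\to v_{i+1}$). An epimorphism from $\langle\mathcal V,\to_{\mathcal V}\rangle$ onto $\langle\mathcal U,\to_{\mathcal U}\rangle$ is a surjection $\phi:\mathcal V\to\mathcal U$ such that $u\to_{\mathcal U}u'$ iff there exist $v\in\phi^{-1}(u)$, $v'\in\phi^{-1}(u')$ with $v\to_{\mathcal V}v'$. An infinite walk is a sequence $\langle v_n\rangle$ with $v_n\to v_{n+1}$ for all $n$; it is diligent if for every edge $v\to w$ there are infinitely many $n$ with $v_n=v$, $v_{n+1}=w$. A walk $\langle b_n\rangle$ almost projects onto $\langle a_n\rangle$ via $\phi$ if $\phi(b_n)=a_n$ for all sufficiently large $n$. Epimorphisms $\phi:\langle\mathcal U,\to_{\mathcal U}\rangle\to\langle\mathcal A,\to_{\mathcal A}\rangle$ and $\psi:\langle\mathcal V,\to_{\mathcal V}\rangle\to\langle\mathcal A,\to_{\mathcal A}\rangle$ between strongly connected digraphs are compatible if there are a strongly connected digraph $\langle\mathcal W,\to_{\mathcal W}\rangle$ and epimorphisms $\bar\phi$ from it onto $\langle\mathcal U,\to_{\mathcal U}\rangle$ and $\bar\psi$ onto $\langle\mathcal V,\to_{\mathcal V}\rangle$ with $\phi\circ\bar\phi=\psi\circ\bar\psi$; otherwise incompatible. *)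

theory Defs
  imports "Graph_Theory.Graph_Theory"
begin

text \<open>
  A digraph is a finite vertex set with a binary relation on it, loops allowed: this is
  \<^locale>\<open>pair_fin_digraph\<close>. \<^const>\<open>strongly_connected\<close> uses walks of length
  at least zero and includes nonemptiness of the vertex set.
\<close>

definition sc_digraph :: "'a pair_pre_digraph \<Rightarrow> bool" where
  "sc_digraph G \<longleftrightarrow> pair_fin_digraph G \<and> strongly_connected (with_proj G)"

text \<open>Only the values of \<open>f\<close> on the vertices of the source matter.\<close>

definition epimorphism ::
  "('v \<Rightarrow> 'u) \<Rightarrow> 'v pair_pre_digraph \<Rightarrow> 'u pair_pre_digraph \<Rightarrow> bool" where
  "epimorphism f V U \<longleftrightarrow>
     f ` pverts V = pverts U \<and>
     (\<forall>u\<in>pverts U. \<forall>u'\<in>pverts U.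
        (u, u') \<in> parcs U \<longleftrightarrow>
        (\<exists>v\<in>pverts V. \<exists>v'\<in>pverts V. f v = u \<and> f v' = u' \<and> (v, v') \<in> parcs V))"

definition infinite_walk :: "'a pair_pre_digraph \<Rightarrow> (nat \<Rightarrow> 'a) \<Rightarrow> bool" where
  "infinite_walk G a \<longleftrightarrow> (\<forall>n. (a n, a (Suc n)) \<in> parcs G)"

definition diligent_walk :: "'a pair_pre_digraph \<Rightarrow> (nat \<Rightarrow> 'a) \<Rightarrow> bool" where
  "diligent_walk G a \<longleftrightarrow>
     infinite_walk G a \<and>
     (\<forall>(v, w) \<in> parcs G. \<exists>\<^sub>\<infinity>n. a n = v \<and> a (Suc n) = w)"

definition almost_projects :: "('b \<Rightarrow> 'a) \<Rightarrow> (nat \<Rightarrow> 'b) \<Rightarrow> (nat \<Rightarrow> 'a) \<Rightarrow> bool" where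
  "almost_projects f b a \<longleftrightarrow> (\<forall>\<^sub>F n in sequentially. f (b n) = a n)"

text \<open>
  For epimorphisms \<open>\<phi>\<close> from \<open>U\<close> and \<open>\<psi>\<close> from \<open>V\<close> onto a common digraph. HOL cannot quantify
  over the vertex type of the witness \<open>W\<close>; as digraphs are finite, vertices of type
  \<^typ>\<open>nat\<close> lose no generality, see lemma \<open>compatible_episI\<close> below.
\<close>

definition compatible_epis ::
  "'u pair_pre_digraph \<Rightarrow> ('u \<Rightarrow> 'a) \<Rightarrow> 'v pair_pre_digraph \<Rightarrow> ('v \<Rightarrow> 'a) \<Rightarrow> bool" where
  "compatible_epis U \<phi> V \<psi> \<longleftrightarrow>
     (\<exists>(W :: nat pair_pre_digraph) \<phi>' \<psi>'.
        sc_digraph W \<and> epimorphism \<phi>' W U \<and> epimorphism \<psi>' W V \<and>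
        (\<forall>w\<in>pverts W. \<phi> (\<phi>' w) = \<psi> (\<psi>' w)))"

definition relabel :: "('a \<Rightarrow> 'b) \<Rightarrow> 'a pair_pre_digraph \<Rightarrow> 'b pair_pre_digraph" where
  "relabel f G = \<lparr> pverts = f ` pverts G, parcs = map_prod f f ` parcs G \<rparr>"

lemma relabel_simps [simp]:
  "pverts (relabel f G) = f ` pverts G"
  "parcs (relabel f G) = map_prod f f ` parcs G"
  by (simp_all add: relabel_def)

lemma sc_digraph_relabel:
  assumes "sc_digraph G"
  shows "sc_digraph (relabel f G)"
proof -
  interpret G: pair_fin_digraph G
    using assms by (simp add: sc_digraph_def)
  have fin: "pair_fin_digraph (relabel f G)"
    using G.pair_finite_verts G.pair_finite_arcs
    by unfold_locales (auto dest: G.wellformed')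
  have "(f u, f v) \<in> rtrancl_on (f ` pverts G) (map_prod f f ` parcs G)"
    if "(u, v) \<in> rtrancl_on (pverts G) (parcs G)" for u v
    using that
  proof (induction rule: rtrancl_on_induct)
    case base
    then show ?case by auto
  next
    case (step v w)
    show ?case
      by (rule rtrancl_on_into_rtrancl_on[OF step.IH]) (use step.hyps in force)+
  qed
  then have "strongly_connected (with_proj (relabel f G))"
    using assms by (auto simp: sc_digraph_def strongly_connected_def reachable_def)
  with fin show ?thesis by (simp add: sc_digraph_def)
qed

lemma epimorphism_relabel:
  assumes inj: "inj_on g (pverts W)" and wf: "pair_wf_digraph W" and epi: "epimorphism f W U"
  shows "epimorphism (f \<circ> inv_into (pverts W) g) (relabel g W) U"
proof -
  have "(g v, g v') \<in> map_prod g g ` parcs W \<longleftrightarrow> (v, v') \<in> parcs W"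
    if "v \<in> pverts W" "v' \<in> pverts W" for v v'
  proof
    assume "(g v, g v') \<in> map_prod g g ` parcs W"
    then obtain x y where xy: "(x, y) \<in> parcs W" "g v = g x" "g v' = g y"
      by auto
    then have "x \<in> pverts W" "y \<in> pverts W"
      using pair_wf_digraph.wellformed'[OF wf] by blast+
    with xy that inj have "v = x" "v' = y"
      by (auto dest: inj_onD)
    with xy show "(v, v') \<in> parcs W" by simp
  next
    assume "(v, v') \<in> parcs W"
    then show "(g v, g v') \<in> map_prod g g ` parcs W" by (metis map_prod_imageI)
  qed
  then show ?thesis
    using epi inj unfolding epimorphism_def by (simp add: image_image)
qed

lemma compatible_episI:
  fixes W :: "'w pair_pre_digraph"
  assumes "sc_digraph W" "epimorphism \<phi>' W U" "epimorphism \<psi>' W V"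
    and "\<And>w. w \<in> pverts W \<Longrightarrow> \<phi> (\<phi>' w) = \<psi> (\<psi>' w)"
  shows "compatible_epis U \<phi> V \<psi>"
proof -
  interpret W: pair_fin_digraph W
    using assms by (simp add: sc_digraph_def)
  obtain g :: "'w \<Rightarrow> nat" where g: "inj_on g (pverts W)"
    using finite_imp_inj_to_nat_seg[OF W.pair_finite_verts] by blast
  have wf: "pair_wf_digraph W" by unfold_locales
  show ?thesis
    unfolding compatible_epis_def
  proof (intro exI conjI)
    show "sc_digraph (relabel g W)"
      by (rule sc_digraph_relabel[OF assms(1)])
    show "epimorphism (\<phi>' \<circ> inv_into (pverts W) g) (relabel g W) U"
      by (rule epimorphism_relabel[OF g wf assms(2)])
    show "epimorphism (\<psi>' \<circ> inv_into (pverts W) g) (relabel g W) V"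
      by (rule epimorphism_relabel[OF g wf assms(3)])
    show "\<forall>w\<in>pverts (relabel g W). \<phi> ((\<phi>' \<circ> inv_into (pverts W) g) w) =
        \<psi> ((\<psi>' \<circ> inv_into (pverts W) g) w)"
      using g assms(4) by simp
  qed
qed

end

theory Submission
  imports Defs "HOL-Library.Ramsey"
begin

text \<open>
  To a segment \<open>a\<^sub>m, \<dots>, a\<^sub>n\<close> of the walk attach its profile: the set of triples
  \<open>(b, b', S)\<close> such that some lift of the segment to \<open>B\<close> runs from \<open>b\<close> to \<open>b'\<close> and has edge
  set \<open>S\<close>. Profiles compose along concatenation and there are only finitely many of them, so
  Ramsey's theorem yields an infinite set \<open>Y\<close> of times such that all segments between elements
  of \<open>Y\<close> have the same, hence idempotent, profile \<open>T\<close>. If \<open>(b, b, S) \<in> T\<close> for some \<open>b\<close>, where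
  \<open>S\<close> is the set of all edges of \<open>B\<close>, then concatenating lifts of consecutive segments gives a
  diligent lift. Otherwise let \<open>c\<^sub>n\<close> be the pair of \<open>a\<^sub>n\<close> and the profile of the segment
  from the last element of \<open>Y\<close> up to \<open>n\<close>, and let \<open>C\<close> consist of the vertices and edges that
  \<open>c\<close> visits infinitely often. Closed walks in \<open>C\<close> through a point with trivial profile lie over
  words of profile \<open>T\<close>, so a common strongly connected cover of \<open>C\<close> and \<open>B\<close> would, via a closed
  walk using all its edges, put \<open>(b, b, S)\<close> into \<open>T\<close>.
\<close>

section \<open>Recurrent digraphs\<close>

definition recurrent_digraph :: "(nat \<Rightarrow> 'c) \<Rightarrow> 'c pair_pre_digraph" where
  "recurrent_digraph c =
     \<lparr> pverts = {v. \<exists>\<^sub>\<infinity>n. c n = v}, parcs = {(v, w). \<exists>\<^sub>\<infinity>n. c n = v \<and> c (Suc n) = w} \<rparr>"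

lemma recurrent_digraph_simps [simp]:
  "v \<in> pverts (recurrent_digraph c) \<longleftrightarrow> (\<exists>\<^sub>\<infinity>n. c n = v)"
  "(v, w) \<in> parcs (recurrent_digraph c) \<longleftrightarrow> (\<exists>\<^sub>\<infinity>n. c n = v \<and> c (Suc n) = w)"
  by (simp_all add: recurrent_digraph_def)

lemma INFM_pigeonhole:
  assumes "\<exists>\<^sub>\<infinity>n. P n" and "finite (range c)"
  obtains v where "\<exists>\<^sub>\<infinity>n. P n \<and> c n = v"
proof -
  have "\<exists>\<^sub>\<infinity>n. \<exists>v\<in>range c. P n \<and> c n = v"
    using assms(1) by simp
  then have "\<exists>v\<in>range c. \<exists>\<^sub>\<infinity>n. P n \<and> c n = v"
    using assms(2) by (simp only: INFM_finite_Bex_distrib)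
  then show ?thesis using that by blast
qed

lemma INFM_pigeonhole_Suc:
  assumes "\<exists>\<^sub>\<infinity>n. P n" and "finite (range c)"
  obtains v w where "\<exists>\<^sub>\<infinity>n. P n \<and> c n = v \<and> c (Suc n) = w"
proof -
  obtain v where v: "\<exists>\<^sub>\<infinity>n. P n \<and> c n = v"
    using INFM_pigeonhole[OF assms] .
  have "finite (range (\<lambda>n. c (Suc n)))"
    by (rule finite_subset[OF _ assms(2)]) auto
  with v obtain w where "\<exists>\<^sub>\<infinity>n. (P n \<and> c n = v) \<and> c (Suc n) = w"
    by (rule INFM_pigeonhole)
  then show ?thesis using that[of v w] by simp
qed

text \<open>Infinitely many exceptional steps would, by the pigeonhole principle, include one pair
  of values infinitely often, and such a pair is an arc by definition.\<close>

lemma eventually_arc_recurrent_digraph: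
  assumes "finite (range c)"
  shows "\<forall>\<^sub>F n in sequentially. (c n, c (Suc n)) \<in> parcs (recurrent_digraph c)"
proof (rule ccontr)
  assume "\<not> ?thesis"
  then have "\<exists>\<^sub>\<infinity>n. (c n, c (Suc n)) \<notin> parcs (recurrent_digraph c)"
    unfolding frequently_def cofinite_eq_sequentially by simp
  then obtain v w where
    vw: "\<exists>\<^sub>\<infinity>n. (c n, c (Suc n)) \<notin> parcs (recurrent_digraph c) \<and> c n = v \<and> c (Suc n) = w"
    using assms by (rule INFM_pigeonhole_Suc)
  then have "(v, w) \<in> parcs (recurrent_digraph c)"
    by simp (erule INFM_mono, simp)
  moreover have "(v, w) \<notin> parcs (recurrent_digraph c)"
    using INFM_EX[OF vw] by blast
  ultimately show False by simp
qed

lemma walk_reachable: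
  assumes "\<And>k. m \<le> k \<Longrightarrow> (c k, c (Suc k)) \<in> parcs G" "pair_wf_digraph G" "m \<le> n"
  shows "c m \<rightarrow>\<^sup>*\<^bsub>with_proj G\<^esub> c n"
  using assms(3)
proof (induction n rule: dec_induct)
  case base
  then show ?case
    using assms(1)[of m] pair_wf_digraph.wellformed'[OF assms(2)]
    by (auto simp: reachable_def)
next
  case (step n)
  have "(c n, c (Suc n)) \<in> parcs G" "c (Suc n) \<in> pverts G"
    using assms(1) step.hyps pair_wf_digraph.wellformed'[OF assms(2)] by blast+
  then show ?case
    using step.IH unfolding reachable_def by (auto intro: rtrancl_on_into_rtrancl_on)
qed

text \<open>Beyond some time \<open>c\<close> follows arcs only, and every vertex recurs beyond it;
  the stretch from a late visit of \<open>u\<close> to a later visit of \<open>v\<close> is the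
  required walk.\<close>

lemma sc_digraph_recurrent_digraph:
  assumes "finite (range c)"
  shows "sc_digraph (recurrent_digraph c)"
proof -
  let ?G = "recurrent_digraph c"
  have verts: "pverts ?G \<subseteq> range c"
    by (auto dest!: INFM_EX)
  have arcs: "u \<in> pverts ?G \<and> v \<in> pverts ?G" if "(u, v) \<in> parcs ?G" for u v
  proof -
    have uv: "\<exists>\<^sub>\<infinity>n. c n = u \<and> c (Suc n) = v" using that by simp
    have "\<exists>n>m. c n = v" for m
      using uv unfolding INFM_nat by (meson less_SucI lessI less_trans)
    then show ?thesis using uv by (auto simp: INFM_nat)
  qed
  have fin: "pair_fin_digraph ?G"
  proof
    show "finite (pverts ?G)" using verts assms finite_subset by blast
    moreover have "parcs ?G \<subseteq> pverts ?G \<times> pverts ?G" using arcs by auto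
    ultimately show "finite (parcs ?G)" using finite_subset by blast
  qed (use arcs in auto)
  then have wf: "pair_wf_digraph ?G" by (simp add: pair_fin_digraph_def)
  obtain N where N: "(c n, c (Suc n)) \<in> parcs ?G" if "N \<le> n" for n
    using eventually_arc_recurrent_digraph[OF assms] by (auto simp: eventually_sequentially)
  have "u \<rightarrow>\<^sup>*\<^bsub>with_proj ?G\<^esub> v" if "u \<in> pverts ?G" "v \<in> pverts ?G" for u v
  proof -
    obtain m where m: "m \<ge> N" "c m = u" using \<open>u \<in> _\<close> by (auto simp: INFM_nat_le)
    obtain n where n: "n \<ge> m" "c n = v" using \<open>v \<in> _\<close> by (auto simp: INFM_nat_le)
    show ?thesis
      using walk_reachable[of m c ?G n] N wf m n by (auto dest: le_trans)
  qed
  moreover have "pverts ?G \<noteq> {}"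
    using N[of N] arcs by blast
  ultimately show ?thesis
    using fin by (auto simp: sc_digraph_def strongly_connected_def)
qed

text \<open>
  A recurrent sequence that is only eventually a walk is repaired by replacing its first \<open>N\<close> terms
  with those preceding a later visit to its \<open>N\<close>-th vertex.
\<close>

lemma diligent_walk_of_eventually:
  assumes walk: "\<And>n. N \<le> n \<Longrightarrow> (b n, b (Suc n)) \<in> parcs G"
    and freq: "\<And>v w. (v, w) \<in> parcs G \<Longrightarrow> \<exists>\<^sub>\<infinity>n. b n = v \<and> b (Suc n) = w"
  obtains b' where "diligent_walk G b'" and "\<And>n. N \<le> n \<Longrightarrow> b' n = b n"
proof -
  \<comment> \<open>The bound \<open>2 * N\<close> places the copied stretch at indices from
    \<open>N\<close> on, where \<open>b\<close> is a walk; \<open>b M = b N\<close> closes the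
    seam.\<close>
  obtain M where M: "2 * N \<le> M" "b M = b N"
    using freq[OF walk[of N]] by (auto simp: INFM_nat_le)
  define b' where "b' n = (if n < N then b (n + (M - N)) else b n)" for n
  have "(b' n, b' (Suc n)) \<in> parcs G" for n
  proof -
    consider "Suc n < N" | "Suc n = N" | "N \<le> n" by linarith
    then show ?thesis
    proof cases
      case 1
      then show ?thesis using walk[of "n + (M - N)"] M by (auto simp: b'_def)
    next
      case 2
      then have "Suc (n + (M - N)) = M" using M by simp
      then show ?thesis using walk[of "n + (M - N)"] M 2 by (auto simp: b'_def)
    next
      case 3
      then show ?thesis using walk[of n] by (auto simp: b'_def)
    qed
  qed
  moreover have "\<exists>\<^sub>\<infinity>n. b' n = v \<and> b' (Suc n) = w" if vw: "(v, w) \<in> parcs G" for v w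
  proof -
    have "\<exists>n\<ge>m. b' n = v \<and> b' (Suc n) = w" for m
    proof -
      obtain n where "n \<ge> max m N" "b n = v" "b (Suc n) = w"
        using freq[OF vw] unfolding INFM_nat_le by blast
      then show ?thesis by (intro exI[of _ n]) (auto simp: b'_def)
    qed
    then show ?thesis by (simp add: INFM_nat_le)
  qed
  ultimately have "diligent_walk G b'"
    by (auto simp: diligent_walk_def infinite_walk_def)
  then show ?thesis using that by (auto simp: b'_def)
qed

lemma recurrent_digraph_diligent_walk:
  assumes "finite (range c)"
  obtains c' where "diligent_walk (recurrent_digraph c) c'"
    and "\<forall>\<^sub>F n in sequentially. c' n = c n"
proof -
  obtain N where N: "(c n, c (Suc n)) \<in> parcs (recurrent_digraph c)" if "N \<le> n" for n
    using eventually_arc_recurrent_digraph[OF assms] by (auto simp: eventually_sequentially)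
  have "\<exists>\<^sub>\<infinity>n. c n = v \<and> c (Suc n) = w" if "(v, w) \<in> parcs (recurrent_digraph c)" for v w
    using that by simp
  from diligent_walk_of_eventually[of N c "recurrent_digraph c", OF N this] obtain c'
    where c': "diligent_walk (recurrent_digraph c) c'" "\<And>n. N \<le> n \<Longrightarrow> c' n = c n" by blast
  show ?thesis
    by (rule that[OF c'(1)]) (use c'(2) in \<open>auto simp: eventually_sequentially\<close>)
qed

text \<open>A single vertex without a loop is strongly connected, so some arc must be given. A walk
  from \<open>x\<close> to its source \<open>u\<close> either starts with an arc out of
  \<open>x\<close> or is trivial, and then \<open>(u, v)\<close> itself leaves
  \<open>x\<close>.\<close>

lemma sc_digraph_out_arc:
  assumes "sc_digraph G" "(u, v) \<in> parcs G" "x \<in> pverts G"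
  obtains y where "(x, y) \<in> parcs G"
proof -
  have "pair_wf_digraph G" using assms(1) by (simp add: sc_digraph_def pair_fin_digraph_def)
  then have "u \<in> pverts G" using assms(2) by (rule pair_wf_digraph.wellformed')
  then have "(x, u) \<in> rtrancl_on (pverts G) (parcs G)"
    using assms(1,3) by (auto simp: sc_digraph_def strongly_connected_def reachable_def)
  then show ?thesis
    by (cases rule: converse_rtrancl_on_cases) (use assms(2) that in auto)
qed

lemma diligent_walk_visits:
  assumes "sc_digraph G" "diligent_walk G a" "x \<in> pverts G"
  shows "\<exists>\<^sub>\<infinity>n. a n = x"
proof -
  have "(a 0, a (Suc 0)) \<in> parcs G"
    using assms(2) by (auto simp: diligent_walk_def infinite_walk_def)
  then obtain y where "(x, y) \<in> parcs G"
    using sc_digraph_out_arc assms(1,3) by metis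
  then have "\<exists>\<^sub>\<infinity>n. a n = x \<and> a (Suc n) = y"
    using assms(2) by (auto simp: diligent_walk_def)
  then show ?thesis by (auto elim: INFM_mono)
qed

text \<open>Every vertex and every arc of \<open>A\<close> recurs along \<open>a\<close>; as
  \<open>c\<close> has finite range, one lift of it recurs along \<open>c\<close>. Conversely, a
  single visit of \<open>c\<close> already projects into \<open>A\<close>.\<close>

lemma epimorphism_recurrent_digraph:
  assumes A: "sc_digraph A" and a: "diligent_walk A a" and c: "finite (range c)"
    and proj: "\<And>n. \<psi> (c n) = a n"
  shows "epimorphism \<psi> (recurrent_digraph c) A"
proof -
  let ?C = "recurrent_digraph c"
  have walk: "(a n, a (Suc n)) \<in> parcs A" for n
    using a by (auto simp: diligent_walk_def infinite_walk_def)
  have wf: "pair_wf_digraph A" "pair_wf_digraph ?C"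
    using A sc_digraph_recurrent_digraph[OF c] by (simp_all add: sc_digraph_def pair_fin_digraph_def)
  show ?thesis
    unfolding epimorphism_def
  proof (intro conjI ballI iffI)
    show "\<psi> ` pverts ?C = pverts A"
    proof (intro equalityI subsetI)
      fix x assume "x \<in> \<psi> ` pverts ?C"
      then obtain n where "x = a n" using proj by (auto dest!: INFM_EX)
      then show "x \<in> pverts A" using walk pair_wf_digraph.wellformed'[OF wf(1)] by blast
    next
      fix x assume "x \<in> pverts A"
      then have "\<exists>\<^sub>\<infinity>n. a n = x" using diligent_walk_visits A a by metis
      then obtain v where v: "\<exists>\<^sub>\<infinity>n. a n = x \<and> c n = v" using c by (rule INFM_pigeonhole)
      then have "\<psi> v = x" using proj by (auto dest!: INFM_EX)
      moreover have "v \<in> pverts ?C" using v by simp (erule INFM_mono, simp)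
      ultimately show "x \<in> \<psi> ` pverts ?C" by blast
    qed
  next
    fix x y assume "(x, y) \<in> parcs A"
    then have "\<exists>\<^sub>\<infinity>n. a n = x \<and> a (Suc n) = y" using a by (auto simp: diligent_walk_def)
    then obtain v w where
      vw: "\<exists>\<^sub>\<infinity>n. (a n = x \<and> a (Suc n) = y) \<and> c n = v \<and> c (Suc n) = w"
      using c by (rule INFM_pigeonhole_Suc)
    then have "\<psi> v = x" "\<psi> w = y" using proj by (auto dest!: INFM_EX)
    moreover have vw': "(v, w) \<in> parcs ?C" using vw by simp (erule INFM_mono, simp)
    moreover have "v \<in> pverts ?C" "w \<in> pverts ?C"
      using pair_wf_digraph.wellformed'[OF wf(2) vw'] by simp_all
    ultimately show "\<exists>v\<in>pverts ?C. \<exists>w\<in>pverts ?C. \<psi> v = x \<and> \<psi> w = y \<and> (v, w) \<in> parcs ?C"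
      by blast
  next
    fix x y
    assume "\<exists>v\<in>pverts ?C. \<exists>w\<in>pverts ?C. \<psi> v = x \<and> \<psi> w = y \<and> (v, w) \<in> parcs ?C"
    then obtain n where "x = a n" "y = a (Suc n)" using proj by (auto dest!: INFM_EX)
    then show "(x, y) \<in> parcs A" using walk by simp
  qed
qed

section \<open>Trails covering all edges\<close>

text \<open>A walk reduced to what a profile records: its endpoints and the exact set of arcs
  used.\<close>

inductive trail :: "'v pair_pre_digraph \<Rightarrow> 'v \<Rightarrow> 'v \<Rightarrow> ('v \<times> 'v) set \<Rightarrow> bool"
  for G u where
  refl: "trail G u u {}"
| step: "trail G u v S \<Longrightarrow> (v, w) \<in> parcs G \<Longrightarrow> trail G u w (insert (v, w) S)"

lemma trail_trans:
  assumes "trail G v w S'" "trail G u v S"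
  shows "trail G u w (S \<union> S')"
  using assms
proof (induction rule: trail.induct)
  case (step w S' x)
  then show ?case using trail.step[of G u w "S \<union> S'" x] by simp
qed auto

lemma trail_arcs: "trail G u v S \<Longrightarrow> S \<subseteq> parcs G"
  by (induction rule: trail.induct) auto

lemma reachable_trail:
  "(u, v) \<in> rtrancl_on (pverts G) (parcs G) \<Longrightarrow> \<exists>S. trail G u v S"
  by (induction rule: rtrancl_on_induct) (auto intro: trail.intros)

text \<open>Excursions from \<open>u\<close> across one arc at a time and back to \<open>u\<close>
  are concatenated. The induction only asks for a set of arcs containing \<open>F\<close>; at
  \<open>F = parcs G\<close> it cannot be larger.\<close>

lemma sc_digraph_closed_trail:
  assumes G: "sc_digraph G" and u: "u \<in> pverts G"
  shows "trail G u u (parcs G)"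
proof -
  interpret G: pair_fin_digraph G using G by (simp add: sc_digraph_def)
  have conn: "\<exists>S. trail G v w S" if "v \<in> pverts G" "w \<in> pverts G" for v w
    using G that by (intro reachable_trail) (auto simp: sc_digraph_def strongly_connected_def reachable_def)
  have "\<exists>S. F \<subseteq> S \<and> trail G u u S" if "finite F" "F \<subseteq> parcs G" for F
    using that
  proof (induction F)
    case empty
    show ?case by (intro exI[of _ "{}"]) (simp add: trail.refl)
  next
    case (insert e F)
    obtain v w where e: "e = (v, w)" by (cases e)
    then have vw: "(v, w) \<in> parcs G" using insert.prems by simp
    then obtain P Q where "trail G u v P" "trail G w u Q"
      using conn[OF u] conn[OF _ u] G.wellformed'[OF vw] by blast
    then have "trail G u u (insert (v, w) P \<union> Q)"
      using vw by (auto intro: trail_trans trail.step simp del: Un_insert_left)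
    moreover obtain S where "F \<subseteq> S" "trail G u u S" using insert by auto
    ultimately have "trail G u u (S \<union> (insert (v, w) P \<union> Q))" using trail_trans by metis
    then show ?case using e \<open>F \<subseteq> S\<close> by (intro exI conjI) auto
  qed
  then obtain S where "parcs G \<subseteq> S" "trail G u u S"
    using G.pair_finite_arcs by blast
  then show ?thesis using trail_arcs by (metis subset_antisym)
qed

section \<open>Arcs under epimorphisms\<close>

lemma epimorphism_vert: "epimorphism f V U \<Longrightarrow> v \<in> pverts V \<Longrightarrow> f v \<in> pverts U"
  by (auto simp: epimorphism_def)

lemma epimorphism_arc:
  assumes "epimorphism f V U" "pair_wf_digraph V" "(v, w) \<in> parcs V"
  shows "(f v, f w) \<in> parcs U"
proof -
  have "v \<in> pverts V" "w \<in> pverts V"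
    using pair_wf_digraph.wellformed'[OF assms(2,3)] by simp_all
  moreover from this have "f v \<in> pverts U" "f w \<in> pverts U"
    using epimorphism_vert assms(1) by metis+
  ultimately show ?thesis using assms(1,3) unfolding epimorphism_def by metis
qed

lemma epimorphism_image_arcs:
  assumes "epimorphism f V U" "pair_wf_digraph V" "pair_wf_digraph U"
  shows "map_prod f f ` parcs V = parcs U"
proof (intro equalityI subsetI)
  fix e assume "e \<in> map_prod f f ` parcs V"
  then show "e \<in> parcs U" using epimorphism_arc[OF assms(1,2)] by auto
next
  fix e assume e: "e \<in> parcs U"
  obtain x y where xy: "e = (x, y)" by (cases e)
  then have "x \<in> pverts U" "y \<in> pverts U"
    using pair_wf_digraph.wellformed'[OF assms(3)] e by blast+
  then obtain v w where "f v = x" "f w = y" "(v, w) \<in> parcs V"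
    using assms(1) e xy unfolding epimorphism_def by blast
  then show "e \<in> map_prod f f ` parcs V" using xy by force
qed

section \<open>Profiles\<close>

type_synonym 'b profile = "('b \<times> 'b \<times> ('b \<times> 'b) set) set"

definition profile_comp :: "'b profile \<Rightarrow> 'b profile \<Rightarrow> 'b profile" (infixl \<open>\<odot>\<close> 70) where
  "s \<odot> t = {(b, b'', S \<union> S') |b b' b'' S S'. (b, b', S) \<in> s \<and> (b', b'', S') \<in> t}"

definition unit_profile :: "'b pair_pre_digraph \<Rightarrow> 'b profile" where
  "unit_profile B = {(b, b, {}) |b. b \<in> pverts B}"

definition arc_profile :: "'b pair_pre_digraph \<Rightarrow> ('b \<Rightarrow> 'a) \<Rightarrow> 'a \<Rightarrow> 'a \<Rightarrow> 'b profile" where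
  "arc_profile B \<phi> x y = {(b, b', {(b, b')}) |b b'. (b, b') \<in> parcs B \<and> \<phi> b = x \<and> \<phi> b' = y}"

text \<open>The \<open>else\<close> branch is the empty segment when \<open>m = Suc n\<close> and a
  default value for larger \<open>m\<close>. An empty segment puts no condition on \<phi>, so its
  profile holds all vertices of \<open>B\<close>, not only those above \<open>a m\<close>.\<close>

primrec profile ::
  "'b pair_pre_digraph \<Rightarrow> ('b \<Rightarrow> 'a) \<Rightarrow> (nat \<Rightarrow> 'a) \<Rightarrow> nat \<Rightarrow> nat \<Rightarrow> 'b profile" where
  "profile B \<phi> a m 0 = unit_profile B"
| "profile B \<phi> a m (Suc n) =
     (if m \<le> n then profile B \<phi> a m n \<odot> arc_profile B \<phi> (a n) (a (Suc n)) else unit_profile B)"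

lemma profile_self [simp]: "profile B \<phi> a m m = unit_profile B"
  by (cases m) auto

lemma profile_compI: "(b, b', S) \<in> s \<Longrightarrow> (b', b'', S') \<in> t \<Longrightarrow> (b, b'', S \<union> S') \<in> s \<odot> t"
  by (auto simp: profile_comp_def)

lemma profile_compE:
  assumes "(b, b'', R) \<in> s \<odot> t"
  obtains b' S S' where "(b, b', S) \<in> s" "(b', b'', S') \<in> t" "R = S \<union> S'"
  using assms by (auto simp: profile_comp_def)

lemma profile_comp_assoc: "s \<odot> t \<odot> u = s \<odot> (t \<odot> u)"
proof (intro set_eqI iffI; clarify)
  fix b b' R assume "(b, b', R) \<in> s \<odot> t \<odot> u"
  then show "(b, b', R) \<in> s \<odot> (t \<odot> u)"
    by (elim profile_compE) (simp only: Un_assoc, (rule profile_compI | assumption)+)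
next
  fix b b' R assume "(b, b', R) \<in> s \<odot> (t \<odot> u)"
  then show "(b, b', R) \<in> s \<odot> t \<odot> u"
    by (elim profile_compE) (simp only: Un_assoc[symmetric], (rule profile_compI | assumption)+)
qed

context
  fixes B :: "'b pair_pre_digraph" and \<phi> :: "'b \<Rightarrow> 'a" and a :: "nat \<Rightarrow> 'a"
  assumes fin: "pair_fin_digraph B"
begin

interpretation B: pair_fin_digraph B by (rule fin)

lemma profile_subset: "profile B \<phi> a m n \<subseteq> pverts B \<times> pverts B \<times> Pow (parcs B)" (is "_ \<subseteq> ?X")
proof (induction n)
  case (Suc n)
  have "unit_profile B \<subseteq> ?X" by (auto simp: unit_profile_def)
  moreover have "arc_profile B \<phi> (a n) (a (Suc n)) \<subseteq> ?X"
    by (auto simp: arc_profile_def dest: B.wellformed')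
  moreover have "s \<odot> t \<subseteq> ?X" if "s \<subseteq> ?X" "t \<subseteq> ?X" for s t
    using that unfolding profile_comp_def by blast
  ultimately show ?case using Suc.IH by simp
qed (auto simp: unit_profile_def)

lemma finite_profiles: "finite (range (case_prod (profile B \<phi> a)))"
proof (rule finite_subset)
  show "range (case_prod (profile B \<phi> a)) \<subseteq> Pow (pverts B \<times> pverts B \<times> Pow (parcs B))"
    using profile_subset by auto
qed simp

text \<open>The bound on \<open>s\<close> keeps endpoints inside \<open>B\<close>, where the unit
  has its identities.\<close>

lemma profile_comp_unit:
  assumes "s \<subseteq> pverts B \<times> pverts B \<times> Pow (parcs B)"
  shows "s \<odot> unit_profile B = s"
  using assms by (force simp: profile_comp_def unit_profile_def)

lemma profile_append:
  assumes "m \<le> n" "n \<le> k"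
  shows "profile B \<phi> a m k = profile B \<phi> a m n \<odot> profile B \<phi> a n k"
  using assms(2)
proof (induction k rule: dec_induct)
  case base
  then show ?case by (simp add: profile_comp_unit[OF profile_subset])
next
  case (step k)
  then show ?case using assms(1) by (simp add: profile_comp_assoc)
qed

text \<open>Recovers an actual lift from a recorded triple. The projection is claimed only for
  \<open>k < n\<close>, since an empty segment does not constrain its vertex; when blocks are glued,
  the next block covers time \<open>n\<close>.\<close>

lemma profile_lift:
  assumes "m \<le> n" "(b, b', S) \<in> profile B \<phi> a m n"
  shows "\<exists>\<beta>. \<beta> m = b \<and> \<beta> n = b' \<and> S = (\<lambda>k. (\<beta> k, \<beta> (Suc k))) ` {m..<n} \<and>
    (\<forall>k\<in>{m..<n}. (\<beta> k, \<beta> (Suc k)) \<in> parcs B \<and> \<phi> (\<beta> k) = a k)"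
  using assms
proof (induction n arbitrary: b' S rule: dec_induct)
  case base
  then show ?case by (auto simp: unit_profile_def)
next
  case (step n)
  from step.prems \<open>m \<le> n\<close> obtain d R where d: "(b, d, R) \<in> profile B \<phi> a m n"
    and e: "(d, b') \<in> parcs B" "\<phi> d = a n" "S = insert (d, b') R"
    by (auto simp: arc_profile_def elim!: profile_compE)
  from step.IH[OF d] obtain \<beta> where \<beta>: "\<beta> m = b" "\<beta> n = d"
    "R = (\<lambda>k. (\<beta> k, \<beta> (Suc k))) ` {m..<n}"
    "\<forall>k\<in>{m..<n}. (\<beta> k, \<beta> (Suc k)) \<in> parcs B \<and> \<phi> (\<beta> k) = a k" by blast
  define \<gamma> where "\<gamma> = \<beta>(Suc n := b')"
  have \<gamma>: "\<gamma> k = \<beta> k" if "k \<le> n" for k using that by (simp add: \<gamma>_def)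
  have ivl: "{m..<Suc n} = insert n {m..<n}" using \<open>m \<le> n\<close> by auto
  have "(\<lambda>k. (\<gamma> k, \<gamma> (Suc k))) ` {m..<n} = R"
    unfolding \<beta>(3) by (rule image_cong) (auto simp: \<gamma>)
  moreover have "\<gamma> (Suc n) = b'" by (simp add: \<gamma>_def)
  moreover have "\<forall>k\<in>{m..<n}. (\<gamma> k, \<gamma> (Suc k)) \<in> parcs B \<and> \<phi> (\<gamma> k) = a k"
    using \<beta>(4) by (auto simp: \<gamma>)
  ultimately show ?case
    using \<beta>(1,2) e \<gamma>[of m] \<gamma>[of n] \<open>m \<le> n\<close> by (intro exI[of _ \<gamma>]) (auto simp: ivl)
qed

lemma profile_homogeneous_set:
  obtains Y T where "infinite Y"
    and "\<And>m n. m \<in> Y \<Longrightarrow> n \<in> Y \<Longrightarrow> m < n \<Longrightarrow> profile B \<phi> a m n = T" and "T \<odot> T = T"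
proof -
  obtain f :: "'b profile \<Rightarrow> nat" and s
    where f: "f ` range (case_prod (profile B \<phi> a)) = {i. i < s}"
      "inj_on f (range (case_prod (profile B \<phi> a)))"
    using finite_imp_inj_to_nat_seg[OF finite_profiles] by metis
  \<comment> \<open>Ramsey's theorem colours unordered pairs; \<open>Min\<close> and
    \<open>Max\<close> restore the order of the endpoints.\<close>
  define h where "h X = f (profile B \<phi> a (Min X) (Max X))" for X
  have "\<forall>x\<in>UNIV. \<forall>y\<in>UNIV. x \<noteq> y \<longrightarrow> h {x, y} < s"
    using f(1) by (auto simp: h_def)
  from Ramsey2[OF infinite_UNIV_nat this] obtain Y t where Y: "infinite Y"
    and t: "\<forall>x\<in>Y. \<forall>y\<in>Y. x \<noteq> y \<longrightarrow> h {x, y} = t" by blast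
  have eq: "profile B \<phi> a m n = profile B \<phi> a k l"
    if "m \<in> Y" "n \<in> Y" "m < n" "k \<in> Y" "l \<in> Y" "k < l" for m n k l
  proof (rule inj_onD[OF f(2)])
    have "h {m, n} = h {k, l}" using t that by auto
    then show "f (profile B \<phi> a m n) = f (profile B \<phi> a k l)" using that by (simp add: h_def)
  qed (auto intro: range_eqI[of _ _ "(_, _)"])
  obtain x where x: "x \<in> Y" using Y by (metis finite.emptyI ex_in_conv)
  obtain y where y: "y \<in> Y" "x < y" using Y by (auto simp: infinite_nat_iff_unbounded)
  obtain z where z: "z \<in> Y" "y < z" using Y by (auto simp: infinite_nat_iff_unbounded)
  \<comment> \<open>Three elements of \<open>Y\<close> suffice for idempotence: all three profiles
    here are equal.\<close>
  have "profile B \<phi> a x z = profile B \<phi> a x y \<odot> profile B \<phi> a y z"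
    using y z by (simp add: profile_append)
  then have idem: "profile B \<phi> a x y \<odot> profile B \<phi> a x y = profile B \<phi> a x y"
    using eq[of x z x y] eq[of y z x y] x y z by simp
  show ?thesis by (rule that[OF Y eq[OF _ _ _ x y] idem])
qed

end

section \<open>Blocks between elements of an infinite set of times\<close>

text \<open>Junk when no element of \<open>Y\<close> is at most \<open>n\<close>.\<close>

definition last_in :: "nat set \<Rightarrow> nat \<Rightarrow> nat" where
  "last_in Y n = Max {y \<in> Y. y \<le> n}"

lemma last_in_mem:
  assumes "y \<in> Y" "y \<le> n"
  shows "last_in Y n \<in> Y" "last_in Y n \<le> n"
proof -
  have "last_in Y n \<in> {y \<in> Y. y \<le> n}"
    unfolding last_in_def by (rule Max_in) (use assms in auto)
  then show "last_in Y n \<in> Y" "last_in Y n \<le> n" by auto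
qed

lemma last_in_self: "n \<in> Y \<Longrightarrow> last_in Y n = n"
  unfolding last_in_def by (rule Max_eqI) auto

lemma last_in_Suc: "Suc n \<notin> Y \<Longrightarrow> last_in Y (Suc n) = last_in Y n"
  unfolding last_in_def by (rule arg_cong[where f = Max]) (auto simp: le_Suc_eq)

lemma last_in_greatest: "y \<in> Y \<Longrightarrow> y \<le> n \<Longrightarrow> y \<le> last_in Y n"
  unfolding last_in_def by (rule Max_ge) auto

text \<open>Blocks can be glued because all of them start and end at \<open>x\<close>, and every arc
  recurs because each block uses all arcs of \<open>B\<close>. Times before \<open>Y\<close> starts
  are left to the repair of an eventual walk.\<close>

lemma diligent_lift_of_blocks:
  assumes Y: "infinite Y"
    and lift: "\<And>m n. m \<in> Y \<Longrightarrow> n \<in> Y \<Longrightarrow> m < n \<Longrightarrow>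
      \<exists>\<beta>. \<beta> m = x \<and> \<beta> n = x \<and> parcs B = (\<lambda>k. (\<beta> k, \<beta> (Suc k))) ` {m..<n} \<and>
        (\<forall>k\<in>{m..<n}. (\<beta> k, \<beta> (Suc k)) \<in> parcs B \<and> \<phi> (\<beta> k) = a k)"
  shows "\<exists>b. diligent_walk B b \<and> almost_projects \<phi> b a"
proof -
  define next_in where "next_in m = (LEAST n. n \<in> Y \<and> m < n)" for m
  have next_in: "next_in m \<in> Y" "m < next_in m" for m
  proof -
    have "\<exists>n. n \<in> Y \<and> m < n" using Y by (auto simp: infinite_nat_iff_unbounded)
    then have "next_in m \<in> Y \<and> m < next_in m" unfolding next_in_def by (rule LeastI_ex)
    then show "next_in m \<in> Y" "m < next_in m" by auto
  qed
  have next_in_le: "next_in m \<le> n" if "n \<in> Y" "m < n" for m n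
    unfolding next_in_def by (rule Least_le) (use that in simp)
  have "\<forall>m\<in>Y. \<exists>\<beta>. \<beta> m = x \<and> \<beta> (next_in m) = x \<and>
      parcs B = (\<lambda>k. (\<beta> k, \<beta> (Suc k))) ` {m..<next_in m} \<and>
      (\<forall>k\<in>{m..<next_in m}. (\<beta> k, \<beta> (Suc k)) \<in> parcs B \<and> \<phi> (\<beta> k) = a k)"
    using lift next_in by blast
  from bchoice[OF this] obtain \<beta> where \<beta>: "\<And>m. m \<in> Y \<Longrightarrow> \<beta> m m = x \<and> \<beta> m (next_in m) = x \<and>
      parcs B = (\<lambda>k. (\<beta> m k, \<beta> m (Suc k))) ` {m..<next_in m} \<and>
      (\<forall>k\<in>{m..<next_in m}. (\<beta> m k, \<beta> m (Suc k)) \<in> parcs B \<and> \<phi> (\<beta> m k) = a k)"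
    by blast
  define b where "b n = \<beta> (last_in Y n) n" for n
  \<comment> \<open>Both ends of a step are compared with the same block, although
    \<open>Suc k\<close> may already belong to the next one; there both blocks have the value
    \<open>x\<close>.\<close>
  have b: "b k = \<beta> m k \<and> b (Suc k) = \<beta> m (Suc k)" if m: "m \<in> Y" and k: "k \<in> {m..<next_in m}" for m k
  proof -
    have "last_in Y k = m"
    proof (rule antisym)
      show "m \<le> last_in Y k" using m k last_in_greatest by auto
      show "last_in Y k \<le> m"
      proof (rule ccontr)
        assume "\<not> ?thesis"
        then have "next_in m \<le> last_in Y k"
          using next_in_le last_in_mem(1)[of m Y k] m k by simp
        then show False using last_in_mem(2)[of m Y k] m k by simp
      qed
    qed
    moreover have "b (Suc k) = \<beta> m (Suc k)"
    proof (cases "Suc k \<in> Y")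
      case True
      then have "next_in m = Suc k" using k next_in_le[of "Suc k" m] by auto
      then show ?thesis using True \<beta>[of "Suc k"] \<beta>[OF m] by (simp add: b_def last_in_self)
    next
      case False
      then show ?thesis using \<open>last_in Y k = m\<close> by (simp add: b_def last_in_Suc)
    qed
    ultimately show ?thesis by (simp add: b_def)
  qed
  obtain N where N: "N \<in> Y" using Y by (metis finite.emptyI ex_in_conv)
  have block: "last_in Y n \<in> Y \<and> n \<in> {last_in Y n..<next_in (last_in Y n)}" if "N \<le> n" for n
  proof -
    have "n < next_in (last_in Y n)"
    proof (rule ccontr)
      assume "\<not> ?thesis"
      then have "next_in (last_in Y n) \<le> last_in Y n" using next_in(1) last_in_greatest by simp
      then show False using next_in(2)[of "last_in Y n"] by simp
    qed
    then show ?thesis using last_in_mem[OF N that] by auto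
  qed
  have walk: "(b n, b (Suc n)) \<in> parcs B" and proj: "\<phi> (b n) = a n" if "N \<le> n" for n
    using \<beta>[of "last_in Y n"] b[of "last_in Y n" n] block[OF that] by simp_all
  have "\<exists>\<^sub>\<infinity>n. b n = v \<and> b (Suc n) = w" if vw: "(v, w) \<in> parcs B" for v w
  proof -
    have "\<exists>n\<ge>k. b n = v \<and> b (Suc n) = w" for k
    proof -
      obtain m where m: "m \<in> Y" "k < m" using Y by (auto simp: infinite_nat_iff_unbounded)
      obtain n where n: "n \<in> {m..<next_in m}" "v = \<beta> m n" "w = \<beta> m (Suc n)"
        using vw \<beta>[OF m(1)] by auto
      then show ?thesis using b[OF m(1) n(1)] m by (intro exI[of _ n]) auto
    qed
    then show ?thesis by (simp add: INFM_nat_le)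
  qed
  from diligent_walk_of_eventually[of N b B, OF walk this] obtain b'
    where "diligent_walk B b'" "\<And>n. N \<le> n \<Longrightarrow> b' n = b n" by blast
  moreover from this have "almost_projects \<phi> b' a"
    unfolding almost_projects_def eventually_sequentially using proj by (intro exI[of _ N]) simp
  ultimately show ?thesis by blast
qed

section \<open>The recurrent digraph of the running profile\<close>

text \<open>The map \<open>d\<close> decodes a vertex into a point of \<open>A\<close> and a running
  profile, so \<open>c\<close> may take values in any type. Since \<open>B\<close> has arcs, the
  empty trail is not one that uses them all.\<close>

lemma running_profile_incompatible:
  fixes d :: "'c \<Rightarrow> 'a \<times> 'b profile"
  assumes B: "sc_digraph B" and ne: "parcs B \<noteq> {}"
    and Y: "infinite Y"
    and T: "\<And>m n. m \<in> Y \<Longrightarrow> n \<in> Y \<Longrightarrow> m < n \<Longrightarrow> profile B \<phi> a m n = T" "T \<odot> T = T"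
    and notin: "\<And>x. (x, x, parcs B) \<notin> T"
    and c: "finite (range c)" and d: "\<And>n. d (c n) = (a n, profile B \<phi> a (last_in Y n) n)"
  shows "\<not> compatible_epis (recurrent_digraph c) (fst \<circ> d) B \<phi>"
proof
  let ?C = "recurrent_digraph c"
  assume "compatible_epis ?C (fst \<circ> d) B \<phi>"
  then obtain W :: "nat pair_pre_digraph" and \<gamma> \<beta> where W: "sc_digraph W"
    and \<gamma>: "epimorphism \<gamma> W ?C" and \<beta>: "epimorphism \<beta> W B"
    and comm: "\<And>w. w \<in> pverts W \<Longrightarrow> fst (d (\<gamma> w)) = \<phi> (\<beta> w)"
    unfolding compatible_epis_def by auto
  have fin: "pair_fin_digraph B" and wf: "pair_wf_digraph W" "pair_wf_digraph B"
    using B W by (simp_all add: sc_digraph_def pair_fin_digraph_def)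
  obtain N where N: "N \<in> Y" using Y by (metis finite.emptyI ex_in_conv)
  have T_unit: "T \<odot> unit_profile B = T"
  proof -
    obtain m where "m \<in> Y" "N < m" using Y by (auto simp: infinite_nat_iff_unbounded)
    then have "profile B \<phi> a N m = T" using T(1) N by simp
    then show ?thesis using profile_comp_unit[OF fin profile_subset[OF fin, of \<phi> a N m]] by simp
  qed
  have "\<exists>\<^sub>\<infinity>n. n \<in> Y" using Y by (simp add: INFM_iff_infinite)
  \<comment> \<open>At times in \<open>Y\<close> the running profile has just been reset to the
    unit; a vertex recurring at such times serves as base point.\<close>
  then obtain v where v: "\<exists>\<^sub>\<infinity>n. n \<in> Y \<and> c n = v" using c by (rule INFM_pigeonhole)
  then obtain n where "n \<in> Y" "c n = v" by (auto dest!: INFM_EX)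
  then have v_unit: "snd (d v) = unit_profile B" using d[of n] by (simp add: last_in_self)
  have "v \<in> pverts ?C" using v by simp (erule INFM_mono, simp)
  then obtain u where u: "u \<in> pverts W" "\<gamma> u = v"
    using \<gamma> unfolding epimorphism_def by (metis imageE)
  \<comment> \<open>The image of a trail is recorded by the running profile at its end, preceded by
    \<open>T\<close> once a reset has occurred. The arcs of the trail need not occur at consecutive
    times of \<open>c\<close>: the running profile is determined by the vertex.\<close>
  have inv: "(\<beta> u, \<beta> w, map_prod \<beta> \<beta> ` S) \<in> snd (d (\<gamma> w)) \<union> T \<odot> snd (d (\<gamma> w))"
    if "trail W u w S" for w S
    using that
  proof (induction rule: trail.induct)
    case refl
    have "\<beta> u \<in> pverts B" using epimorphism_vert \<beta> u(1) by metis
    then show ?case using u v_unit by (simp add: unit_profile_def)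
  next
    case (step w S w')
    have verts: "w \<in> pverts W" "w' \<in> pverts W"
      using pair_wf_digraph.wellformed'[OF wf(1) step.hyps(2)] by simp_all
    have "(\<gamma> w, \<gamma> w') \<in> parcs ?C" using epimorphism_arc \<gamma> wf(1) step.hyps(2) by metis
    \<comment> \<open>The arc recurs, so a time after \<open>N\<close> can be chosen, where
      \<open>last_in\<close> is not junk.\<close>
    then obtain n where n: "N \<le> n" "\<gamma> w = c n" "\<gamma> w' = c (Suc n)"
      unfolding recurrent_digraph_simps INFM_nat_le by metis
    let ?l = "last_in Y n" and ?e = "arc_profile B \<phi> (a n) (a (Suc n))"
    have l: "?l \<in> Y" "?l \<le> n" using last_in_mem[OF N n(1)] by auto
    have "(\<beta> w, \<beta> w') \<in> parcs B" using epimorphism_arc \<beta> wf(1) step.hyps(2) by metis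
    moreover have "\<phi> (\<beta> w) = a n" "\<phi> (\<beta> w') = a (Suc n)"
      using comm[OF verts(1)] comm[OF verts(2)] n d by simp_all
    ultimately have e: "(\<beta> w, \<beta> w', {(\<beta> w, \<beta> w')}) \<in> ?e" by (auto simp: arc_profile_def)
    let ?p = "profile B \<phi> a ?l (Suc n)"
    from step.IH have "(\<beta> u, \<beta> w, map_prod \<beta> \<beta> ` S) \<in> profile B \<phi> a ?l n \<union> T \<odot> profile B \<phi> a ?l n"
      by (simp add: n d)
    then have "(\<beta> u, \<beta> w', map_prod \<beta> \<beta> ` S \<union> {(\<beta> w, \<beta> w')}) \<in> ?p \<union> T \<odot> ?p"
      using l profile_compI[OF _ e] by (auto simp flip: profile_comp_assoc)
    moreover have "?p \<union> T \<odot> ?p \<subseteq> snd (d (\<gamma> w')) \<union> T \<odot> snd (d (\<gamma> w'))"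
    \<comment> \<open>If \<open>Suc n\<close> lies in \<open>Y\<close>, the completed block has
      profile \<open>T\<close>, which idempotence absorbs into any earlier \<open>T\<close>, and the
      running profile returns to the unit.\<close>
    proof (cases "Suc n \<in> Y")
      case True
      then have "?p = T" using T(1) l by (simp del: profile.simps)
      then show ?thesis using True T(2) T_unit by (simp add: n d last_in_self del: profile.simps)
    next
      case False
      then show ?thesis by (simp add: n d last_in_Suc)
    qed
    ultimately show ?case by auto
  qed
  \<comment> \<open>A closed trail through all arcs of \<open>W\<close> maps onto all arcs of
    \<open>B\<close> and ends where the running profile is the unit.\<close>
  have "(\<beta> u, \<beta> u, parcs B) \<in> unit_profile B \<union> T \<odot> unit_profile B"
    using inv[OF sc_digraph_closed_trail[OF W u(1)]] epimorphism_image_arcs[OF \<beta> wf] u v_unit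
    by simp
  then show False using ne notin T_unit by (auto simp: unit_profile_def)
qed

theorem theorem10p2:
  fixes A :: "'a pair_pre_digraph" and B :: "'b pair_pre_digraph"
    and \<phi> :: "'b \<Rightarrow> 'a" and a :: "nat \<Rightarrow> 'a"
  assumes "sc_digraph A" and "sc_digraph B"
    and "epimorphism \<phi> B A"
    and "diligent_walk A a"
  shows "(\<exists>b. diligent_walk B b \<and> almost_projects \<phi> b a) \<or>
    (\<exists>(C :: nat pair_pre_digraph) \<psi>.
       sc_digraph C \<and> epimorphism \<psi> C A \<and>
       (\<exists>c. diligent_walk C c \<and> almost_projects \<psi> c a) \<and>
       \<not> compatible_epis C \<psi> B \<phi>)"
proof -
  have A: "pair_fin_digraph A" and B: "pair_fin_digraph B"
    and wf: "pair_wf_digraph A" "pair_wf_digraph B"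
    using assms(1,2) by (simp_all add: sc_digraph_def pair_fin_digraph_def)
  have walk: "(a n, a (Suc n)) \<in> parcs A" for n
    using assms(4) by (auto simp: diligent_walk_def infinite_walk_def)
  obtain Y T where Y: "infinite Y"
    and T: "\<And>m n. m \<in> Y \<Longrightarrow> n \<in> Y \<Longrightarrow> m < n \<Longrightarrow> profile B \<phi> a m n = T" "T \<odot> T = T"
    using profile_homogeneous_set[OF B] by metis
  show ?thesis
  proof (cases "\<exists>x. (x, x, parcs B) \<in> T")
    case True
    then obtain x where "(x, x, parcs B) \<in> T" by blast
    then have "\<exists>b. diligent_walk B b \<and> almost_projects \<phi> b a"
      using T(1) by (intro diligent_lift_of_blocks[OF Y] profile_lift[OF B]) auto
    then show ?thesis ..
  next
    case False
    define s where "s n = (a n, profile B \<phi> a (last_in Y n) n)" for n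
    have "range s \<subseteq> pverts A \<times> range (case_prod (profile B \<phi> a))"
      using walk pair_wf_digraph.wellformed'[OF wf(1)]
      by (auto simp: s_def intro: range_eqI[of _ _ "(_, _)"])
    then have fin_s: "finite (range s)"
      using finite_profiles[OF B] pair_fin_digraph.pair_finite_verts[OF A]
      by (meson finite_SigmaI finite_subset)
    \<comment> \<open>The sequence \<open>s\<close> takes finitely many values, so \<open>g\<close>
      can code them as natural numbers, the vertex type required of \<open>C\<close>.\<close>
    then obtain g :: "'a \<times> 'b profile \<Rightarrow> nat" where g: "inj_on g (range s)"
      using finite_imp_inj_to_nat_seg[OF fin_s] by blast
    define c where "c = g \<circ> s"
    define d where "d = inv_into (range s) g"
    have c: "finite (range c)"
      unfolding c_def image_comp[symmetric] using fin_s by (rule finite_imageI)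
    have d: "d (c n) = s n" for n
      unfolding c_def d_def comp_apply by (rule inv_into_f_f[OF g]) simp
    obtain c' where c': "diligent_walk (recurrent_digraph c) c'"
      "\<forall>\<^sub>F n in sequentially. c' n = c n"
      using recurrent_digraph_diligent_walk[OF c] .
    have "almost_projects (fst \<circ> d) c' a"
      unfolding almost_projects_def
      using c'(2) by (rule eventually_mono) (simp add: d s_def)
    moreover have "epimorphism (fst \<circ> d) (recurrent_digraph c) A"
      by (rule epimorphism_recurrent_digraph[OF assms(1,4) c]) (simp add: d s_def)
    \<comment> \<open>The walk \<open>a\<close> provides an arc of \<open>A\<close>, and arcs of
      \<open>A\<close> are images of arcs of \<open>B\<close>.\<close>
    moreover have "parcs B \<noteq> {}"
      using epimorphism_image_arcs[OF assms(3) wf(2,1)] walk by auto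
    then have "\<not> compatible_epis (recurrent_digraph c) (fst \<circ> d) B \<phi>"
      using False d unfolding s_def
      by (intro running_profile_incompatible[OF assms(2) _ Y T _ c]) auto
    ultimately show ?thesis using c'(1) sc_digraph_recurrent_digraph[OF c] by blast
  qed
qed

end
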